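(* For the proper lower semicontinuous (l.s.c.) function $F=f+g$, the following assertions hold. (a) Suppose that $F$ satisfies the Kurdyka–Łojasiewicz (KŁ) property at $\bar x$ with exponent $\alpha\in[0,1)$ over $\mathfrak{B}(\bar x;\eta,\nu)$. Then $F$ satisfies the level-set subdifferential error bound condition at $\bar x$ with exponent $\gamma=\frac{\alpha}{1-\alpha}$ over $\mathfrak{B}(\bar x;\frac{\eta}{2},\nu)$. So $\alpha=\frac{\gamma}{1+\gamma}$. As a consequence, if $\alpha\in[0,\frac12]$, then $\gamma\in(0,1]$, and if $\alpha\in(\frac12,1)$, then $\gamma>1$. (b) Suppose Assumption 1 (listed in the context) holds, and Assumption (H) holds at $\bar x\in\bar{\mathbf{X}}_P$. If one of the following conditions holds: (i) the Bregman proximal error bound holds at $\bar x$, and $g$ is semi-convex; (ii) $\partial_PF$ is weakly metrically subregular at $\bar x$ for the zero vector $0$; then the level-set subdifferential error bound condition holds at $\bar x$ with exponent $\gamma=1$.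
   Context: $\langle\cdot,\cdot\rangle$ and $\|\cdot\|$ are the Euclidean inner product and norm on $\mathbb{R}^n$; $\mathrm{dist}(x,C)=\inf_{z\in C}\|x-z\|$, $\mathrm{dist}(x,\emptyset)=\infty$; $\mathbb{B}(\bar x;\eta)$ is the open ball of radius $\eta$ centered at $\bar x$. $\bar x\in\mathrm{dom}\,F$, $\bar F=F(\bar x)$, $[F\le\bar F]=\{x:F(x)\le\bar F\}$, $\mathfrak{B}(\bar x;\eta,\nu)=\mathbb{B}(\bar x;\eta)\cap\{x:\bar F<F(x)<\bar F+\nu\}$ for $\eta,\nu>0$. Assumption 1: (i) $f:\mathbb{R}^n\to(-\infty,\infty]$ is proper l.s.c., differentiable on $\mathrm{dom}\,f$, $\mathrm{dom}\,f$ is convex, and $\nabla f$ is $L$-Lipschitz; (ii) $g:\mathbb{R}^n\to(-\infty,\infty]$ is proper l.s.c. and $\mathrm{dom}\,g$ is convex; (iii) $F$ is level-bounded: $\{x:F(x)\le r\}$ is bounded (possibly empty) for every $r\in\mathbb{R}$. Bregman function: $D(x,y)=K(y)-[K(x)+\langle\nabla K(x),y-x\rangle]$, where $K$ is twice differentiable and strongly convex with modulus $m$, $\nabla K$ is $M$-Lipschitz, and the accompanying parameter satisfies $0<\underline{\epsilon}\le\epsilon\le\overline{\epsilon}$ (standing assumption). $T_{D,\epsilon}(x)=\operatorname{argmin}_{y\in\mathbb{R}^n}\{\langle\nabla f(x),y-x\rangle+g(y)+\frac1\epsilon D(x,y)\}$. Subdifferentials at $u\in\mathrm{dom}\,\psi$: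 $\partial_P\psi(u)$ (proximal) is the set of $\xi$ for which there are $\rho'>0$, $\delta'>0$ with $\psi(x)\ge\psi(u)+\langle\xi,x-u\rangle-\rho'\|x-u\|^2$ for all $x\in\mathbb{B}(u;\delta')$; $\partial_F\psi(u)$ (Fréchet) is the set of $\xi$ with $\liminf_{x\to u,\,x\ne u}\|x-u\|^{-1}[\psi(x)-\psi(u)-\langle\xi,x-u\rangle]\ge0$ (empty outside $\mathrm{dom}\,\psi$); $\partial_L\psi(u)$ (limiting) is the set of limits of $\xi_n\in\partial_F\psi(x_n)$ with $x_n\to u$, $\psi(x_n)\to\psi(u)$. $\bar{\mathbf{X}}_P=\{x:0\in\partial_PF(x)\}$. An l.s.c. function $\psi$ is semi-convex (on $\mathrm{dom}\,\psi$) with modulus $\rho>0$ if there is a convex function $h:\mathbb{R}^n\to\mathbb{R}$ with $\psi(x)=h(x)-\frac{\rho}{2}\|x\|^2$. Assumption (H) at $\bar x\in\bar{\mathbf{X}}_P$: there is $\delta>0$ such that $F(y)\le F(\bar x)$ whenever $y\in\bar{\mathbf{X}}_P$ and $\|y-\bar x\|\le\delta$. KŁ property at $\bar x$ with exponent $\alpha$ over $\mathfrak{B}(\bar x;\eta,\nu)$: there is $c_5>0$ with $\mathrm{dist}(0,\partial_LF(x))\ge c_5[F(x)-\bar F]^\alpha$ for all $x\in\mathfrak{B}(\bar x;\eta,\nu)$. Level-set subdifferential error bound at $\bar x$ with exponent $\gamma$ over $\mathfrak{B}(\bar x;\eta,\nu)$: there is $c_1>0$ with $\mathrm{dist}^\gamma(x,[F\le\bar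 F])\le c_1\,\mathrm{dist}(0,\partial_PF(x))$ for all $x\in\mathfrak{B}(\bar x;\eta,\nu)$; it holds at $\bar x$ if this is so for some $\eta,\nu>0$. Bregman proximal error bound at $\bar x\in\bar{\mathbf{X}}_P$ (for a given Bregman function $D$ along with $\epsilon>0$): there are $\eta,\nu,c_3>0$ with $\mathrm{dist}(x,\bar{\mathbf{X}}_P)\le c_3\,\mathrm{dist}(x,T_{D,\epsilon}(x))$ for all $x\in\mathfrak{B}(\bar x;\eta,\nu)$. Weak metric subregularity of $\partial_PF$ at $\bar x\in\bar{\mathbf{X}}_P$ for $0$: there are $\eta,\nu,c_2>0$ with $\mathrm{dist}(x,\bar{\mathbf{X}}_P)\le c_2\,\mathrm{dist}(0,\partial_PF(x))$ for all $x\in\mathfrak{B}(\bar x;\eta,\nu)$.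
   Formalization: In (a), for α=0 one has γ=0, so γ∈(0,1] is claimed only for α≠0 (γ∈[0,1] otherwise). In (b)(i), ερ<m is added for some semi-convexity modulus ρ of g; without it f=x²/2, g=x⁴−x²/2, K=x²/2, ε=1 is a counterexample. Differentiability on dom f is two-sided. *)

theory Defs
  imports "HOL-Analysis.Analysis"
begin

text \<open>Extended-real-valued functions have type \<open>real^'n \<Rightarrow> ereal\<close>; that they avoid
  \<open>-\<infinity>\<close> is part of \<open>proper_fun\<close>.\<close>

definition edom :: "(real^'n \<Rightarrow> ereal) \<Rightarrow> (real^'n) set" where
  "edom \<psi> = {x. \<psi> x < \<infinity>}"

definition proper_fun :: "(real^'n \<Rightarrow> ereal) \<Rightarrow> bool" where
  "proper_fun \<psi> \<longleftrightarrow> (\<forall>x. \<psi> x \<noteq> -\<infinity>) \<and> edom \<psi> \<noteq> {}"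

definition lsc :: "(real^'n \<Rightarrow> ereal) \<Rightarrow> bool" where
  "lsc \<psi> \<longleftrightarrow> (\<forall>x. \<psi> x \<le> Liminf (at x) \<psi>)"

definition level_bounded :: "(real^'n \<Rightarrow> ereal) \<Rightarrow> bool" where
  "level_bounded \<psi> \<longleftrightarrow> (\<forall>r::real. bounded {x. \<psi> x \<le> ereal r})"

text \<open>Distance to a set with value \<open>\<infinity>\<close> at the empty set (unlike \<open>infdist\<close>, which is \<open>0\<close> there).\<close>

definition ext_dist :: "real^'n \<Rightarrow> (real^'n) set \<Rightarrow> ereal" where
  "ext_dist x C = (INF z\<in>C. ereal (norm (x - z)))"


subsection \<open>Subdifferentials\<close>

definition prox_subdiff :: "(real^'n \<Rightarrow> ereal) \<Rightarrow> real^'n \<Rightarrow> (real^'n) set" where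
  "prox_subdiff \<psi> u = {\<xi>. u \<in> edom \<psi> \<and>
     (\<exists>\<rho>>0. \<exists>\<delta>>0. \<forall>x\<in>ball u \<delta>.
        \<psi> u + ereal (\<xi> \<bullet> (x - u) - \<rho> * (norm (x - u))\<^sup>2) \<le> \<psi> x)}"

definition frechet_subdiff :: "(real^'n \<Rightarrow> ereal) \<Rightarrow> real^'n \<Rightarrow> (real^'n) set" where
  "frechet_subdiff \<psi> u = {\<xi>. u \<in> edom \<psi> \<and>
     0 \<le> Liminf (at u) (\<lambda>x. ereal (inverse (norm (x - u))) * (\<psi> x - \<psi> u - ereal (\<xi> \<bullet> (x - u))))}"

definition lim_subdiff :: "(real^'n \<Rightarrow> ereal) \<Rightarrow> real^'n \<Rightarrow> (real^'n) set" where
  "lim_subdiff \<psi> u = {\<xi>. u \<in> edom \<psi> \<and>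
     (\<exists>X \<Xi>. (\<forall>k::nat. \<Xi> k \<in> frechet_subdiff \<psi> (X k)) \<and>
        X \<longlonglongrightarrow> u \<and> (\<lambda>k. \<psi> (X k)) \<longlonglongrightarrow> \<psi> u \<and> \<Xi> \<longlonglongrightarrow> \<xi>)}"

definition prox_critical :: "(real^'n \<Rightarrow> ereal) \<Rightarrow> (real^'n) set" where
  "prox_critical F = {x. 0 \<in> prox_subdiff F x}"


subsection \<open>Assumptions on the data\<close>

text \<open>The gradient of an extended-valued function at a point is the usual (two-sided) one, so the
  function has to be finite in a neighbourhood. The interior condition is needed because
  \<open>real_of_ereal \<infinity> = 0\<close>.\<close>

definition has_gradient :: "(real^'n \<Rightarrow> ereal) \<Rightarrow> real^'n \<Rightarrow> real^'n \<Rightarrow> bool" where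
  "has_gradient \<psi> x v \<longleftrightarrow>
     x \<in> interior (edom \<psi>) \<and> (GDERIV (\<lambda>y. real_of_ereal (\<psi> y)) x :> v)"

definition assumption1 ::
  "(real^'n \<Rightarrow> ereal) \<Rightarrow> (real^'n \<Rightarrow> real^'n) \<Rightarrow> real \<Rightarrow> (real^'n \<Rightarrow> ereal) \<Rightarrow> bool" where
  "assumption1 f gradf L g \<longleftrightarrow>
     proper_fun f \<and> lsc f \<and> convex (edom f) \<and>
     (\<forall>x\<in>edom f. has_gradient f x (gradf x)) \<and> L-lipschitz_on (edom f) gradf \<and>
     proper_fun g \<and> lsc g \<and> convex (edom g) \<and>
     level_bounded (\<lambda>x. f x + g x)"

text \<open>The convex function \<open>h\<close> may be \<open>\<infinity>\<close> off \<open>edom \<psi>\<close>; it is represented by its finite values there.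
  A function \<open>h\<close> that is real-valued and convex on the whole space is a special case
  whenever \<open>edom \<psi>\<close> is convex.\<close>

definition semi_convex :: "real \<Rightarrow> (real^'n \<Rightarrow> ereal) \<Rightarrow> bool" where
  "semi_convex \<rho> \<psi> \<longleftrightarrow> \<rho> > 0 \<and> lsc \<psi> \<and>
     (\<exists>h. convex_on (edom \<psi>) h \<and> (\<forall>x\<in>edom \<psi>. \<psi> x = ereal (h x - \<rho> / 2 * (norm x)\<^sup>2)))"

definition strongly_convex :: "real \<Rightarrow> (real^'n \<Rightarrow> real) \<Rightarrow> bool" where
  "strongly_convex m K \<longleftrightarrow> m > 0 \<and>
     (\<forall>x y. \<forall>t\<in>{0..1}. K (t *\<^sub>R x + (1 - t) *\<^sub>R y)
        \<le> t * K x + (1 - t) * K y - m / 2 * t * (1 - t) * (norm (x - y))\<^sup>2)"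

definition bregman_kernel ::
  "(real^'n \<Rightarrow> real) \<Rightarrow> (real^'n \<Rightarrow> real^'n) \<Rightarrow> real \<Rightarrow> real \<Rightarrow> bool" where
  "bregman_kernel K gradK m M \<longleftrightarrow>
     (\<forall>x. GDERIV K x :> gradK x) \<and> (\<forall>x. gradK differentiable (at x)) \<and>
     strongly_convex m K \<and> M-lipschitz_on UNIV gradK"

definition bregman_dist ::
  "(real^'n \<Rightarrow> real) \<Rightarrow> (real^'n \<Rightarrow> real^'n) \<Rightarrow> real^'n \<Rightarrow> real^'n \<Rightarrow> real" where
  "bregman_dist K gradK x y = K y - (K x + gradK x \<bullet> (y - x))"

definition bregman_prox ::
  "(real^'n \<Rightarrow> real^'n) \<Rightarrow> (real^'n \<Rightarrow> ereal) \<Rightarrow> (real^'n \<Rightarrow> real^'n \<Rightarrow> real) \<Rightarrow> real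
     \<Rightarrow> real^'n \<Rightarrow> (real^'n) set" where
  "bregman_prox gradf g D \<epsilon> x =
     {y. is_arg_min (\<lambda>z. ereal (gradf x \<bullet> (z - x)) + g z + ereal (1 / \<epsilon> * D x z)) (\<lambda>_. True) y}"

definition assumptionH :: "(real^'n \<Rightarrow> ereal) \<Rightarrow> real^'n \<Rightarrow> bool" where
  "assumptionH F xb \<longleftrightarrow>
     (\<exists>\<delta>>0. \<forall>y\<in>prox_critical F. norm (y - xb) \<le> \<delta> \<longrightarrow> F y \<le> F xb)"


subsection \<open>Regularity conditions at a point\<close>

definition level_ball :: "(real^'n \<Rightarrow> ereal) \<Rightarrow> real^'n \<Rightarrow> real \<Rightarrow> real \<Rightarrow> (real^'n) set" where
  "level_ball F xb \<eta> \<nu> = ball xb \<eta> \<inter> {x. F xb < F x \<and> F x < F xb + ereal \<nu>}"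

definition KL_property ::
  "(real^'n \<Rightarrow> ereal) \<Rightarrow> real^'n \<Rightarrow> real \<Rightarrow> real \<Rightarrow> real \<Rightarrow> bool" where
  "KL_property F xb \<alpha> \<eta> \<nu> \<longleftrightarrow>
     (\<exists>c>0. \<forall>x\<in>level_ball F xb \<eta> \<nu>.
        ereal (c * real_of_ereal (F x - F xb) powr \<alpha>) \<le> ext_dist 0 (lim_subdiff F x))"

text \<open>The level set contains \<open>xb\<close>, so \<open>ext_dist\<close> to it is finite. For lower semicontinuous \<open>F\<close> the
  level set is closed and \<open>x\<close> lies outside it, so the base of \<open>powr\<close> is positive and the convention
  \<open>0 powr 0 = 0\<close> plays no role.\<close>

definition level_set_EB ::
  "(real^'n \<Rightarrow> ereal) \<Rightarrow> real^'n \<Rightarrow> real \<Rightarrow> real \<Rightarrow> real \<Rightarrow> bool" where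
  "level_set_EB F xb \<gamma> \<eta> \<nu> \<longleftrightarrow>
     (\<exists>c>0. \<forall>x\<in>level_ball F xb \<eta> \<nu>.
        ereal (real_of_ereal (ext_dist x {y. F y \<le> F xb}) powr \<gamma>)
          \<le> ereal c * ext_dist 0 (prox_subdiff F x))"

definition level_set_EB_at :: "(real^'n \<Rightarrow> ereal) \<Rightarrow> real^'n \<Rightarrow> real \<Rightarrow> bool" where
  "level_set_EB_at F xb \<gamma> \<longleftrightarrow> (\<exists>\<eta>>0. \<exists>\<nu>>0. level_set_EB F xb \<gamma> \<eta> \<nu>)"

definition bregman_prox_EB ::
  "(real^'n \<Rightarrow> ereal) \<Rightarrow> (real^'n \<Rightarrow> real^'n) \<Rightarrow> (real^'n \<Rightarrow> ereal)
     \<Rightarrow> (real^'n \<Rightarrow> real^'n \<Rightarrow> real) \<Rightarrow> real \<Rightarrow> real^'n \<Rightarrow> bool" where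
  "bregman_prox_EB F gradf g D \<epsilon> xb \<longleftrightarrow>
     (\<exists>\<eta>>0. \<exists>\<nu>>0. \<exists>c>0. \<forall>x\<in>level_ball F xb \<eta> \<nu>.
        ext_dist x (prox_critical F) \<le> ereal c * ext_dist x (bregman_prox gradf g D \<epsilon> x))"

definition weak_metric_subregular :: "(real^'n \<Rightarrow> ereal) \<Rightarrow> real^'n \<Rightarrow> bool" where
  "weak_metric_subregular F xb \<longleftrightarrow>
     (\<exists>\<eta>>0. \<exists>\<nu>>0. \<exists>c>0. \<forall>x\<in>level_ball F xb \<eta> \<nu>.
        ext_dist x (prox_critical F) \<le> ereal c * ext_dist 0 (prox_subdiff F x))"

end

theory Submission
  imports Defs
begin

text \<open>Part (a): the KL inequality forces the distance to the level set to be at most a multiple of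
  \<open>(F x - F xb) powr (1 - \<alpha>)\<close>, by a penalty argument; raising this to the power
  \<open>\<alpha> / (1 - \<alpha>)\<close> and applying the KL inequality once more gives the error bound, because proximal
  subgradients are limiting ones.

  Part (b): near \<open>xb\<close>, assumption (H) puts the proximal critical points into the level set, so weak
  metric subregularity suffices. It follows from the Bregman error bound: if \<open>\<xi>\<close> is a proximal
  subgradient of \<open>F\<close> at \<open>x\<close>, then \<open>\<xi> - gradf x\<close> is one of \<open>g\<close>, with a global quadratic minorant by
  semi-convexity, so the Bregman objective grows like \<open>\<xi> \<bullet> (y - x)\<close> plus a positive multiple of the
  squared distance and has a minimiser within a multiple of \<open>norm \<xi>\<close> of \<open>x\<close>.\<close>

subsection \<open>Lower semicontinuity and attained minima\<close>

text \<open>A value \<open>r\<close> strictly between \<open>l\<close> and \<open>\<psi> x\<close>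
  would be exceeded by \<open>\<psi>\<close> near \<open>x\<close>, while \<open>a k\<close>
  eventually drops below it.\<close>

lemma lsc_le_limit:
  fixes \<psi> :: "real^'n \<Rightarrow> ereal"
  assumes "lsc \<psi>" and X: "X \<longlonglongrightarrow> x" and a: "a \<longlonglongrightarrow> l" and le: "\<And>k. \<psi> (X k) \<le> a k"
  shows "\<psi> x \<le> l"
proof (rule ccontr)
  assume "\<not> \<psi> x \<le> l"
  then obtain r where r: "l < r" "r < \<psi> x"
    using dense not_le by metis
  then have "r < Liminf (at x) \<psi>"
    using \<open>lsc \<psi>\<close> unfolding lsc_def by (meson less_le_trans)
  then have "\<forall>\<^sub>F y in at x. r < \<psi> y"
    by (rule less_LiminfD)
  \<comment> \<open>The \<open>Liminf\<close> in \<open>lsc\<close> ignores the point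
    \<open>x\<close>, but \<open>X\<close> may visit it; \<open>r < \<psi> x\<close> closes this
    gap.\<close>
  then have "\<forall>\<^sub>F y in nhds x. r < \<psi> y"
    using r(2) by (auto simp: eventually_nhds_conv_at)
  then have "\<forall>\<^sub>F k in sequentially. r < \<psi> (X k)"
    using X by (rule eventually_compose_filterlim)
  moreover have "\<forall>\<^sub>F k in sequentially. a k < r"
    using a r(1) by (rule order_tendstoD)
  ultimately have "\<forall>\<^sub>F k in sequentially. False"
    by eventually_elim (use le not_less order.strict_trans1 in \<open>metis order.asym\<close>)
  then show False
    by simp
qed

lemma lsc_closed_sublevel:
  assumes "lsc \<psi>"
  shows "closed {x. \<psi> x \<le> a}"
  unfolding closed_sequential_limits
  using lsc_le_limit[OF assms _ tendsto_const] by blast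

text \<open>A minimising sequence has values converging to the infimum, and so has its convergent
  subsequence. Hence lower semicontinuity is demanded only within \<open>C\<close> and along
  sequences with convergent values.\<close>

lemma compact_attains_min:
  fixes G :: "'a::metric_space \<Rightarrow> ereal"
  assumes "compact C" "C \<noteq> {}"
    and lower: "\<And>X x a. \<lbrakk>\<And>k. X k \<in> C; x \<in> C; X \<longlonglongrightarrow> x; (\<lambda>k. G (X k)) \<longlonglongrightarrow> a\<rbrakk> \<Longrightarrow> G x \<le> a"
  obtains x where "x \<in> C" "\<And>y. y \<in> C \<Longrightarrow> G x \<le> G y"
proof -
  obtain u where u: "\<And>k::nat. u k \<in> G ` C" "u \<longlonglongrightarrow> Inf (G ` C)"
    using Inf_as_limit[of "G ` C"] \<open>C \<noteq> {}\<close> by auto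
  then have "\<forall>k. \<exists>y\<in>C. G y = u k"
    by (metis imageE)
  then obtain Y where Y: "\<And>k. Y k \<in> C" "\<And>k. G (Y k) = u k"
    by metis
  obtain x r where x: "x \<in> C" "strict_mono r" "(Y \<circ> r) \<longlonglongrightarrow> x"
    using \<open>compact C\<close> Y(1) unfolding compact_def by meson
  have "G x \<le> Inf (G ` C)"
  proof (rule lower)
    show "(\<lambda>k. G ((Y \<circ> r) k)) \<longlonglongrightarrow> Inf (G ` C)"
      using LIMSEQ_subseq_LIMSEQ[OF u(2) x(2)] Y(2) by (simp add: o_def)
  qed (use x Y in \<open>auto simp: o_def\<close>)
  then show thesis
    using that x(1) by (meson INF_lower order_trans)
qed

lemma ext_dist_eq_infdist:
  assumes "C \<noteq> {}"
  shows "ext_dist x C = ereal (infdist x C)"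
proof (rule antisym)
  show "ext_dist x C \<le> ereal (infdist x C)"
  proof (rule ereal_le_epsilon2)
    fix e :: real assume "0 < e"
    then obtain z where "z \<in> C" "dist x z < infdist x C + e"
      using cINF_less_iff[of C "dist x" "infdist x C + e"] assms by (auto simp: infdist_def)
    then show "ext_dist x C \<le> ereal (infdist x C) + ereal e"
      unfolding ext_dist_def by (intro INF_lower2[of z]) (auto simp: dist_norm)
  qed
  show "ereal (infdist x C) \<le> ext_dist x C"
    unfolding ext_dist_def
    by (intro INF_greatest) (auto simp: dist_norm[symmetric] intro: infdist_le)
qed

lemma ext_dist_le: "z \<in> C \<Longrightarrow> ext_dist x C \<le> ereal (norm (x - z))"
  unfolding ext_dist_def by (rule INF_lower)


subsection \<open>Comparison of the subdifferentials\<close>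

text \<open>Division by \<open>norm (x - u)\<close> turns the quadratic defect into
  \<open>- \<rho> * norm (x - u)\<close>, which tends to 0.\<close>

lemma prox_subset_frechet:
  assumes fin: "\<And>x. \<psi> x \<noteq> -\<infinity>"
  shows "prox_subdiff \<psi> u \<subseteq> frechet_subdiff \<psi> u"
proof
  fix \<xi> assume "\<xi> \<in> prox_subdiff \<psi> u"
  then obtain \<rho> \<delta> where u: "u \<in> edom \<psi>" and "\<rho> > 0" "\<delta> > 0"
    and le: "\<And>x. x \<in> ball u \<delta> \<Longrightarrow> \<psi> u + ereal (\<xi> \<bullet> (x - u) - \<rho> * (norm (x - u))\<^sup>2) \<le> \<psi> x"
    unfolding prox_subdiff_def by blast
  obtain p where p: "\<psi> u = ereal p"
    using u fin[of u] by (cases "\<psi> u") (auto simp: edom_def)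
  define Q where "Q x = ereal (inverse (norm (x - u))) * (\<psi> x - \<psi> u - ereal (\<xi> \<bullet> (x - u)))" for x
  have "ereal (- \<rho> * norm (x - u)) \<le> Q x" if "x \<in> ball u \<delta>" "x \<noteq> u" for x
  proof (cases "\<psi> x")
    case (real q)
    then have "- \<rho> * (norm (x - u))\<^sup>2 \<le> q - p - \<xi> \<bullet> (x - u)"
      using le[OF that(1)] p by simp
    then have "- \<rho> * norm (x - u) \<le> inverse (norm (x - u)) * (q - p - \<xi> \<bullet> (x - u))"
      using that(2) by (simp add: field_simps power2_eq_square)
    then show ?thesis
      using real p by (simp add: Q_def)
  next
    case PInf
    then show ?thesis
      using that(2) p by (simp add: Q_def)
  qed (use fin in auto)
  then have "\<forall>\<^sub>F x in at u. ereal (- \<rho> * norm (x - u)) \<le> Q x"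
    unfolding eventually_at using \<open>\<delta> > 0\<close> by (auto simp: dist_commute)
  then have "Liminf (at u) (\<lambda>x. ereal (- \<rho> * norm (x - u))) \<le> Liminf (at u) Q"
    by (rule Liminf_mono)
  moreover have "((\<lambda>x. ereal (- \<rho> * norm (x - u))) \<longlongrightarrow> ereal 0) (at u)"
    by (intro tendsto_ereal) (auto intro!: tendsto_eq_intros)
  then have "Liminf (at u) (\<lambda>x. ereal (- \<rho> * norm (x - u))) = ereal 0"
    by (intro lim_imp_Liminf) auto
  ultimately show "\<xi> \<in> frechet_subdiff \<psi> u"
    using u by (simp add: frechet_subdiff_def Q_def[abs_def] zero_ereal_def)
qed

lemma frechet_subset_lim: "frechet_subdiff \<psi> u \<subseteq> lim_subdiff \<psi> u"
proof
  fix \<xi> assume "\<xi> \<in> frechet_subdiff \<psi> u"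
  then show "\<xi> \<in> lim_subdiff \<psi> u"
    unfolding lim_subdiff_def
    by (intro CollectI conjI exI[of _ "\<lambda>_. u"] exI[of _ "\<lambda>_. \<xi>"])
      (auto simp: frechet_subdiff_def)
qed

lemma prox_subset_lim: "(\<And>x. \<psi> x \<noteq> -\<infinity>) \<Longrightarrow> prox_subdiff \<psi> u \<subseteq> lim_subdiff \<psi> u"
  using prox_subset_frechet frechet_subset_lim by blast


subsection \<open>From the KL inequality to the level-set error bound\<close>

text \<open>Young's inequality places the concave power \<open>s powr (1 - \<alpha>)\<close> below
  its tangent at \<open>t\<close>. The factor \<open>t powr \<alpha> / (1 - \<alpha>)\<close> is the
  reciprocal of the slope there, so a bound between powers becomes one between \<open>s\<close> and
  \<open>t\<close>.\<close>

lemma powr_tangent_bound: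
  fixes s t q \<alpha> :: real
  assumes "0 \<le> \<alpha>" "\<alpha> < 1" "0 < t" "0 \<le> s" and le: "t powr (1 - \<alpha>) - q \<le> s powr (1 - \<alpha>)"
  shows "t - t powr \<alpha> / (1 - \<alpha>) * q \<le> s"
proof -
  have t: "t powr \<alpha> * t powr (1 - \<alpha>) = t"
    using assms by (simp flip: powr_add)
  have "s powr (1 - \<alpha>) * t powr \<alpha> \<le> (1 - \<alpha>) * s + \<alpha> * t"
  proof (cases "s = 0")
    case False
    then show ?thesis
      using Youngs_inequality_0[of "1 - \<alpha>" \<alpha> s t] assms by simp
  qed (use assms in simp)
  moreover have "t powr \<alpha> * (t powr (1 - \<alpha>) - q) \<le> t powr \<alpha> * s powr (1 - \<alpha>)"
    using le by (intro mult_left_mono) auto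
  ultimately have "t - t powr \<alpha> * q \<le> (1 - \<alpha>) * s + \<alpha> * t"
    by (simp add: t algebra_simps)
  moreover have "(1 - \<alpha>) * (t powr \<alpha> / (1 - \<alpha>) * q) = t powr \<alpha> * q"
    using \<open>\<alpha> < 1\<close> by simp
  ultimately have "(1 - \<alpha>) * (t - t powr \<alpha> / (1 - \<alpha>) * q) \<le> (1 - \<alpha>) * s"
    by (simp only: right_diff_distrib) (simp add: algebra_simps)
  then show ?thesis
    using \<open>\<alpha> < 1\<close> by simp
qed

text \<open>If the bound failed at \<open>x\<close>, a minimiser \<open>y\<close> of
  \<open>(F - F xb)\<^sub>+ powr (1 - \<alpha>) + \<mu> * (norm (\<cdot> - x))\<^sup>2\<close> on the ball around \<open>x\<close> that touches the level
  set would be interior and carry a proximal subgradient of \<open>F\<close> too short for the KL inequality.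
  Smoothness of the quadratic penalty makes a sum rule unnecessary.\<close>

lemma KL_imp_dist_le:
  fixes F :: "real^'n \<Rightarrow> ereal"
  assumes "lsc F" and fin: "\<And>x. F x \<noteq> -\<infinity>" and Fb: "F xb = ereal b"
    and \<alpha>: "0 \<le> \<alpha>" "\<alpha> < 1" and "c > 0"
    and KL: "\<And>x. x \<in> level_ball F xb \<eta> \<nu> \<Longrightarrow>
       ereal (c * real_of_ereal (F x - F xb) powr \<alpha>) \<le> ext_dist 0 (lim_subdiff F x)"
    and x: "x \<in> level_ball F xb (\<eta> / 2) \<nu>"
  shows "infdist x {y. F y \<le> F xb} \<le> 2 / (c * (1 - \<alpha>)) * real_of_ereal (F x - F xb) powr (1 - \<alpha>)"
proof (rule ccontr)
  define S where "S = {y. F y \<le> F xb}"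
  define d where "d = infdist x S"
  define A where "A = c * (1 - \<alpha>)"
  \<comment> \<open>This weight meets two demands: \<open>\<mu> * d\<^sup>2 = A * d / 2\<close>
    exceeds \<open>\<phi> x\<close> if the claim fails, and \<open>2 * k * \<mu> * d\<close> below
    equals the KL lower bound at \<open>y\<close>.\<close>
  define \<mu> where "\<mu> = A / (2 * d)"
  define \<phi> where "\<phi> y = max 0 (real_of_ereal (F y) - b) powr (1 - \<alpha>)" for y
  define G where "G y = ereal (\<phi> y + \<mu> * (norm (y - x))\<^sup>2)" for y
  \<comment> \<open>The sublevel set keeps \<open>F\<close> finite on \<open>C\<close>; at infinite
    values \<open>real_of_ereal\<close> would yield 0 and spoil \<open>\<phi>\<close>.\<close>
  define C where "C = cball x d \<inter> {y. F y \<le> F x}"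
  have Fx: "F xb < F x" "F x < F xb + ereal \<nu>" and xxb: "dist xb x < \<eta> / 2"
    using x by (auto simp: level_ball_def)
  obtain a where a: "F x = ereal a"
    using Fx Fb by (cases "F x") auto
  have ab: "b < a" "a < b + \<nu>"
    using Fx Fb a by auto
  assume "\<not> ?thesis"
  then have d: "2 / A * \<phi> x < d"
    using a Fb ab by (simp add: d_def S_def A_def \<phi>_def)
  have "A > 0"
    using \<open>c > 0\<close> \<alpha> by (simp add: A_def)
  have "0 \<le> 2 / A * \<phi> x"
    using \<open>A > 0\<close> by (simp add: \<phi>_def)
  then have "d > 0"
    using d by linarith
  then have "\<mu> > 0"
    using \<open>A > 0\<close> by (simp add: \<mu>_def)
  have "d \<le> dist x xb"
    unfolding d_def by (intro infdist_le) (simp add: S_def)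
  then have d_le: "d < \<eta> / 2"
    using xxb by (simp add: dist_commute)
  have C_fin: "\<exists>r. F y = ereal r" if "y \<in> C" for y
    using that fin[of y] a by (cases "F y") (auto simp: C_def)
  have "compact C"
    unfolding C_def using lsc_closed_sublevel[OF \<open>lsc F\<close>] by (intro compact_Int_closed) auto
  moreover have xC: "x \<in> C"
    using \<open>d > 0\<close> by (simp add: C_def)
  \<comment> \<open>The penalty is continuous, so \<open>\<phi> (X k)\<close> converges. Inverting
    the power bounds \<open>F (X k)\<close>, lower semicontinuity of \<open>F\<close> passes to the
    limit, and the power is applied again.\<close>
  moreover have "G y \<le> l"
    if X: "\<And>k. X k \<in> C" "X \<longlonglongrightarrow> y" "(\<lambda>k. G (X k)) \<longlonglongrightarrow> l" and y: "y \<in> C" for X y l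
  proof (cases l)
    case (real r)
    define t where "t = r - \<mu> * (norm (y - x))\<^sup>2"
    have "(\<lambda>k. \<phi> (X k) + \<mu> * (norm (X k - x))\<^sup>2) \<longlonglongrightarrow> r"
      using X(3) real by (simp add: G_def)
    then have "(\<lambda>k. (\<phi> (X k) + \<mu> * (norm (X k - x))\<^sup>2) - \<mu> * (norm (X k - x))\<^sup>2) \<longlonglongrightarrow> t"
      unfolding t_def using X(2) by (intro tendsto_intros)
    then have \<phi>t: "(\<lambda>k. \<phi> (X k)) \<longlonglongrightarrow> t"
      by simp
    then have "t \<ge> 0"
      by (rule LIMSEQ_le_const) (auto simp: \<phi>_def)
    have "(\<lambda>k. ereal (b + \<phi> (X k) powr (1 / (1 - \<alpha>)))) \<longlonglongrightarrow> ereal (b + t powr (1 / (1 - \<alpha>)))"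
      using \<phi>t \<alpha> by (intro tendsto_intros tendsto_ereal tendsto_powr') (auto simp: \<phi>_def)
    moreover have "F (X k) \<le> ereal (b + \<phi> (X k) powr (1 / (1 - \<alpha>)))" for k
      using C_fin[OF X(1)[of k]] \<alpha> by (auto simp: \<phi>_def powr_powr)
    ultimately have "F y \<le> ereal (b + t powr (1 / (1 - \<alpha>)))"
      using lsc_le_limit[OF \<open>lsc F\<close> X(2)] by blast
    then have "max 0 (real_of_ereal (F y) - b) \<le> t powr (1 / (1 - \<alpha>))"
      using C_fin[OF y] by auto
    then have "\<phi> y \<le> (t powr (1 / (1 - \<alpha>))) powr (1 - \<alpha>)"
      unfolding \<phi>_def using \<alpha> by (intro powr_mono2) auto
    also have "\<dots> = t"
      using \<alpha> \<open>t \<ge> 0\<close> by (simp add: powr_powr)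
    finally show ?thesis
      by (simp add: G_def real t_def)
  next
    case MInf
    have "ereal 0 \<le> l"
      using X(3) \<open>\<mu> > 0\<close> by (intro tendsto_lowerbound[of _ _ sequentially]) (auto simp: G_def \<phi>_def)
    then show ?thesis
      using MInf by simp
  qed simp
  ultimately obtain y where y: "y \<in> C" and min: "\<And>z. z \<in> C \<Longrightarrow> G y \<le> G z"
    using compact_attains_min[of C G] by (metis empty_iff)
  obtain r where r: "F y = ereal r"
    using C_fin[OF y] by blast
  have "\<phi> y + \<mu> * (norm (y - x))\<^sup>2 \<le> \<phi> x"
    using min[OF xC] by (simp add: G_def)
  moreover have "\<phi> x < \<mu> * d\<^sup>2"
    using d \<open>A > 0\<close> \<open>d > 0\<close> by (simp add: \<mu>_def power2_eq_square field_simps)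
  moreover have "0 \<le> \<phi> y"
    by (simp add: \<phi>_def)
  ultimately have "\<mu> * (norm (y - x))\<^sup>2 < \<mu> * d\<^sup>2"
    by linarith
  then have yd: "norm (y - x) < d"
    using \<open>\<mu> > 0\<close> \<open>d > 0\<close> by (simp add: power_less_imp_less_base)
  \<comment> \<open>No point of \<open>S\<close> is closer to \<open>x\<close> than
    \<open>d\<close>. Thus the positive part in \<open>\<phi>\<close> is inactive at
    \<open>y\<close>.\<close>
  have "y \<notin> S"
    using infdist_le[of y S x] yd by (auto simp: d_def dist_norm norm_minus_commute)
  then have "b < r"
    using r Fb by (simp add: S_def)
  \<comment> \<open>Both summands are below \<open>\<eta> / 2\<close>, the second because
    \<open>d \<le> dist x xb\<close>; this is why the radius is halved.\<close>
  have "dist xb y \<le> dist xb x + dist x y"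
    by (rule dist_triangle)
  then have "y \<in> level_ball F xb \<eta> \<nu>"
    using \<open>b < r\<close> r Fb a y ab yd d_le xxb
    by (auto simp: level_ball_def C_def dist_norm norm_minus_commute)
  then have kl: "ereal (c * (r - b) powr \<alpha>) \<le> ext_dist 0 (lim_subdiff F y)"
    using KL[of y] r Fb by simp
  \<comment> \<open>\<open>k\<close> is the reciprocal of the derivative of the power at
    \<open>r - b\<close>; \<open>\<xi>\<close> is minus the gradient of the penalty at
    \<open>y\<close>, rescaled by \<open>k\<close> as the chain rule suggests.\<close>
  define k where "k = (r - b) powr \<alpha> / (1 - \<alpha>)"
  define \<xi> where "\<xi> = (- 2 * k * \<mu>) *\<^sub>R (y - x)"
  have "k > 0"
    using \<open>b < r\<close> \<alpha> by (simp add: k_def)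
  have "F y + ereal (\<xi> \<bullet> (z - y) - k * \<mu> * (norm (z - y))\<^sup>2) \<le> F z" if "z \<in> ball y (d - norm (y - x))" for z
  proof (cases "F z")
    case (real s)
    define q where "q = \<mu> * ((norm (z - x))\<^sup>2 - (norm (y - x))\<^sup>2)"
    have q: "q = \<mu> * (2 * ((y - x) \<bullet> (z - y)) + (norm (z - y))\<^sup>2)"
      unfolding q_def by (simp add: power2_norm_eq_inner inner_diff_left inner_diff_right inner_commute)
    have xz: "dist x z < d"
      using that dist_triangle[of x z y] by (simp add: dist_norm norm_minus_commute)
    \<comment> \<open>Minimality over \<open>C\<close> extends to the open ball around
      \<open>x\<close>: where \<open>F z\<close> exceeds \<open>F x\<close>, already
      \<open>G x \<le> G z\<close>.\<close>
    have "G y \<le> G z"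
    proof (cases "z \<in> C")
      case False
      then have "a < s"
        using xz real a by (auto simp: C_def)
      then have "\<phi> x \<le> \<phi> z"
        using \<alpha> real a by (auto simp: \<phi>_def intro!: powr_mono2)
      then have "G x \<le> G z"
        using \<open>\<mu> > 0\<close> by (simp add: G_def add_increasing2)
      then show ?thesis
        using min[OF xC] by (rule order_trans[rotated])
    qed (rule min)
    then have "(r - b) powr (1 - \<alpha>) - q \<le> max 0 (s - b) powr (1 - \<alpha>)"
      using \<open>b < r\<close> by (simp add: G_def \<phi>_def r real q_def algebra_simps)
    then have *: "r - b - k * q \<le> max 0 (s - b)"
      unfolding k_def using \<alpha> \<open>b < r\<close> by (intro powr_tangent_bound) auto
    have "z \<notin> S"
      using xz infdist_le[of z S x] by (auto simp: d_def)
    then have "b < s"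
      using real Fb by (simp add: S_def)
    then have "r - k * q \<le> s"
      using * by simp
    then show ?thesis
      by (simp add: r real q \<xi>_def algebra_simps)
  qed (use fin in auto)
  then have "\<xi> \<in> prox_subdiff F y"
    unfolding prox_subdiff_def using r yd \<open>k > 0\<close> \<open>\<mu> > 0\<close>
    by (intro CollectI conjI exI[of _ "k * \<mu>"] exI[of _ "d - norm (y - x)"]) (auto simp: edom_def)
  then have "ext_dist 0 (lim_subdiff F y) \<le> ereal (norm (0 - \<xi>))"
    using prox_subset_lim[of F, OF fin] by (intro ext_dist_le) auto
  with kl have "ereal (c * (r - b) powr \<alpha>) \<le> ereal (norm (0 - \<xi>))"
    by (rule order_trans)
  then have "c * (r - b) powr \<alpha> \<le> norm \<xi>"
    by simp
  also have "norm \<xi> = 2 * k * \<mu> * norm (y - x)"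
    using \<open>k > 0\<close> \<open>\<mu> > 0\<close> by (simp add: \<xi>_def)
  also have "\<dots> < 2 * k * \<mu> * d"
    using yd \<open>k > 0\<close> \<open>\<mu> > 0\<close> by simp
  also have "\<dots> = c * (r - b) powr \<alpha>"
    using \<open>d > 0\<close> \<alpha> by (simp add: \<mu>_def k_def A_def)
  finally show False
    by simp
qed

text \<open>Since \<open>(1 - \<alpha>) * \<gamma> = \<alpha>\<close>, the power
  \<open>\<gamma>\<close> of the distance bound is a multiple of \<open>t powr \<alpha>\<close>, the
  very quantity that the KL inequality bounds.\<close>

lemma KL_imp_level_set_EB:
  fixes F :: "real^'n \<Rightarrow> ereal"
  assumes "lsc F" and fin: "\<And>x. F x \<noteq> -\<infinity>" and "xb \<in> edom F"
    and \<alpha>: "0 \<le> \<alpha>" "\<alpha> < 1" and KL: "KL_property F xb \<alpha> \<eta> \<nu>" and "\<eta> > 0"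
  shows "level_set_EB F xb (\<alpha> / (1 - \<alpha>)) (\<eta> / 2) \<nu>"
proof -
  obtain c where "c > 0" and c: "\<And>x. x \<in> level_ball F xb \<eta> \<nu> \<Longrightarrow>
       ereal (c * real_of_ereal (F x - F xb) powr \<alpha>) \<le> ext_dist 0 (lim_subdiff F x)"
    using KL unfolding KL_property_def by blast
  obtain b where b: "F xb = ereal b"
    using \<open>xb \<in> edom F\<close> fin[of xb] by (cases "F xb") (auto simp: edom_def)
  define \<gamma> where "\<gamma> = \<alpha> / (1 - \<alpha>)"
  define B where "B = (2 / (c * (1 - \<alpha>))) powr \<gamma>"
  have "\<gamma> \<ge> 0" "B > 0"
    using \<alpha> \<open>c > 0\<close> by (auto simp: \<gamma>_def B_def)
  have "ereal (real_of_ereal (ext_dist x {y. F y \<le> F xb}) powr \<gamma>)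
      \<le> ereal (B / c) * ext_dist 0 (prox_subdiff F x)"
    if x: "x \<in> level_ball F xb (\<eta> / 2) \<nu>" for x
  proof -
    define t where "t = real_of_ereal (F x - F xb)"
    have "{y. F y \<le> F xb} \<noteq> {}"
      by auto
    then have "real_of_ereal (ext_dist x {y. F y \<le> F xb}) = infdist x {y. F y \<le> F xb}"
      by (simp add: ext_dist_eq_infdist)
    also have "\<dots> \<le> 2 / (c * (1 - \<alpha>)) * t powr (1 - \<alpha>)"
      unfolding t_def by (rule KL_imp_dist_le[OF \<open>lsc F\<close> fin b \<alpha> \<open>c > 0\<close> c x])
    finally have "real_of_ereal (ext_dist x {y. F y \<le> F xb}) powr \<gamma>
        \<le> (2 / (c * (1 - \<alpha>)) * t powr (1 - \<alpha>)) powr \<gamma>"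
      using \<open>\<gamma> \<ge> 0\<close> \<open>{y. F y \<le> F xb} \<noteq> {}\<close>
      by (intro powr_mono2) (auto simp: ext_dist_eq_infdist infdist_nonneg)
    also have "\<dots> = B * t powr \<alpha>"
      unfolding powr_mult using \<alpha> by (simp add: B_def \<gamma>_def powr_powr)
    finally have "ereal (real_of_ereal (ext_dist x {y. F y \<le> F xb}) powr \<gamma>)
        \<le> ereal (B / c) * ereal (c * t powr \<alpha>)"
      using \<open>c > 0\<close> by simp
    also have "\<dots> \<le> ereal (B / c) * ext_dist 0 (lim_subdiff F x)"
      using c[of x] x \<open>\<eta> > 0\<close> \<open>B > 0\<close> \<open>c > 0\<close>
      by (intro ereal_mult_left_mono) (auto simp: level_ball_def t_def)
    \<comment> \<open>The infimum over the smaller set of proximal subgradients is larger, and it is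
      infinite if there are none.\<close>
    also have "\<dots> \<le> ereal (B / c) * ext_dist 0 (prox_subdiff F x)"
      using \<open>B > 0\<close> \<open>c > 0\<close> prox_subset_lim[of F, OF fin]
      by (intro ereal_mult_left_mono) (auto simp: ext_dist_def intro: INF_superset_mono)
    finally show ?thesis .
  qed
  then show ?thesis
    unfolding level_set_EB_def \<gamma>_def[symmetric] using \<open>B > 0\<close> \<open>c > 0\<close>
    by (intro exI[of _ "B / c"]) auto
qed

subsection \<open>Proximal error bounds\<close>

lemma le_if_le_add_small:
  fixes a b k \<tau> :: real
  assumes "0 < \<tau>" "\<And>t. 0 < t \<Longrightarrow> t < \<tau> \<Longrightarrow> a \<le> b + t * k"
  shows "a \<le> b"
proof (rule tendsto_lowerbound)
  show "((\<lambda>t. b + t * k) \<longlongrightarrow> b) (at_right 0)"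
    by (auto intro!: tendsto_eq_intros)
  show "\<forall>\<^sub>F t in at_right 0. a \<le> b + t * k"
    using assms by (auto simp: eventually_at_right_field)
qed simp

section \<open>Proximal subgradients of the sum and of a semi-convex summand\<close>

text \<open>The mean value inequality is applied on a segment to \<open>f\<close> minus its linear
  part at \<open>x\<close>, whose gradient there is at most \<open>L * norm (y - x)\<close>. The
  constant is not sharp, but any quadratic bound serves for proximal subgradients.\<close>

lemma lipschitz_gradient_quadratic_bound:
  assumes grad: "\<And>y. y \<in> edom f \<Longrightarrow> has_gradient f y (gradf y)"
    and lip: "L-lipschitz_on (edom f) gradf" and "x \<in> edom f"
  obtains \<delta> where "\<delta> > 0" "ball x \<delta> \<subseteq> edom f"
    "\<And>y. y \<in> ball x \<delta> \<Longrightarrow>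
      \<bar>real_of_ereal (f y) - real_of_ereal (f x) - gradf x \<bullet> (y - x)\<bar> \<le> L * (norm (y - x))\<^sup>2"
proof -
  have "x \<in> interior (edom f)"
    using grad[OF \<open>x \<in> edom f\<close>] by (simp add: has_gradient_def)
  then obtain \<delta> where \<delta>: "\<delta> > 0" "ball x \<delta> \<subseteq> edom f"
    by (auto simp: mem_interior)
  have "L \<ge> 0"
    using lip by (rule lipschitz_on_nonneg)
  define u where "u z = real_of_ereal (f z) - z \<bullet> gradf x" for z
  have "\<bar>real_of_ereal (f y) - real_of_ereal (f x) - gradf x \<bullet> (y - x)\<bar> \<le> L * (norm (y - x))\<^sup>2"
    if y: "y \<in> ball x \<delta>" for y
  proof -
    have seg: "closed_segment x y \<subseteq> edom f"
      using \<delta> y closed_segment_subset[of x "ball x \<delta>" y] by (auto simp: convex_ball)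
    have "norm (u y - u x) \<le> (L * norm (y - x)) * norm (y - x)"
    proof (rule differentiable_bound[where S = "closed_segment x y"])
      fix z assume z: "z \<in> closed_segment x y"
      have "GDERIV (\<lambda>y. real_of_ereal (f y)) z :> gradf z"
        using grad[of z] z seg by (auto simp: has_gradient_def)
      then have "(u has_derivative (\<lambda>h. h \<bullet> gradf z - h \<bullet> gradf x)) (at z)"
        unfolding u_def gderiv_def by (intro derivative_intros)
      then show "(u has_derivative (\<lambda>h. h \<bullet> (gradf z - gradf x))) (at z within closed_segment x y)"
        by (simp add: inner_diff_right has_derivative_at_withinI)
      have "norm (gradf z - gradf x) \<le> L * norm (z - x)"
        using lipschitz_on_normD[OF lip] z seg \<open>x \<in> edom f\<close> by auto
      also have "\<dots> \<le> L * norm (y - x)"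
        using segment_bound1[OF z] \<open>L \<ge> 0\<close> by (intro mult_left_mono) auto
      finally have le: "norm (gradf z - gradf x) \<le> L * norm (y - x)" .
      show "onorm (\<lambda>h. h \<bullet> (gradf z - gradf x)) \<le> L * norm (y - x)"
      proof (rule onorm_bound)
        fix h
        have "\<bar>h \<bullet> (gradf z - gradf x)\<bar> \<le> norm h * norm (gradf z - gradf x)"
          by (rule Cauchy_Schwarz_ineq2)
        also have "\<dots> \<le> norm h * (L * norm (y - x))"
          using le by (intro mult_left_mono) auto
        finally show "norm (h \<bullet> (gradf z - gradf x)) \<le> L * norm (y - x) * norm h"
          by (simp add: mult.commute)
      qed (use \<open>L \<ge> 0\<close> in simp)
    qed auto
    then show ?thesis
      by (simp add: u_def inner_diff_right inner_commute power2_eq_square algebra_simps)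
  qed
  with \<delta> show thesis
    using that by blast
qed

text \<open>Subtracting the quadratic upper estimate of \<open>f\<close> from the proximal
  inequality only enlarges its constant from \<open>\<rho>\<close> to
  \<open>\<rho> + L\<close>.\<close>

lemma prox_subdiff_minus_gradient:
  fixes f g :: "real^'n \<Rightarrow> ereal"
  assumes finf: "\<And>x. f x \<noteq> -\<infinity>" and fing: "\<And>x. g x \<noteq> -\<infinity>"
    and grad: "\<And>y. y \<in> edom f \<Longrightarrow> has_gradient f y (gradf y)"
    and lip: "L-lipschitz_on (edom f) gradf"
    and \<xi>: "\<xi> \<in> prox_subdiff (\<lambda>x. f x + g x) x"
  shows "\<xi> - gradf x \<in> prox_subdiff g x"
proof -
  obtain \<rho> \<delta> where dom: "f x + g x < \<infinity>" and "\<rho> > 0" "\<delta> > 0"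
    and le: "\<And>y. y \<in> ball x \<delta> \<Longrightarrow>
      f x + g x + ereal (\<xi> \<bullet> (y - x) - \<rho> * (norm (y - x))\<^sup>2) \<le> f y + g y"
    using \<xi> unfolding prox_subdiff_def edom_def by blast
  obtain p q where p: "f x = ereal p" and q: "g x = ereal q"
    using dom finf[of x] fing[of x] by (cases "f x"; cases "g x") auto
  have "x \<in> edom f"
    using p by (simp add: edom_def)
  obtain \<delta>' where "\<delta>' > 0" and dom': "ball x \<delta>' \<subseteq> edom f" and bound: "\<And>y. y \<in> ball x \<delta>' \<Longrightarrow>
      \<bar>real_of_ereal (f y) - real_of_ereal (f x) - gradf x \<bullet> (y - x)\<bar> \<le> L * (norm (y - x))\<^sup>2"
    using lipschitz_gradient_quadratic_bound[OF grad lip \<open>x \<in> edom f\<close>] by blast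
  have "L \<ge> 0"
    using lip by (rule lipschitz_on_nonneg)
  have "g x + ereal ((\<xi> - gradf x) \<bullet> (y - x) - (\<rho> + L) * (norm (y - x))\<^sup>2) \<le> g y"
    if y: "y \<in> ball x (min \<delta> \<delta>')" for y
  proof -
    have "f y < \<infinity>"
      using y dom' by (auto simp: edom_def)
    then obtain s where s: "f y = ereal s"
      using finf[of y] by (cases "f y") auto
    have *: "s - p - gradf x \<bullet> (y - x) \<le> L * (norm (y - x))\<^sup>2"
      using bound[of y] y p s by simp
    show ?thesis
    proof (cases "g y")
      case (real t)
      have "p + q + (\<xi> \<bullet> (y - x) - \<rho> * (norm (y - x))\<^sup>2) \<le> s + t"
        using le[of y] y p q s real by simp
      with * have "q + (\<xi> \<bullet> (y - x) - gradf x \<bullet> (y - x)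
          - (\<rho> * (norm (y - x))\<^sup>2 + L * (norm (y - x))\<^sup>2)) \<le> t"
        by linarith
      then show ?thesis
        using q real by (simp add: inner_diff_left distrib_right)
    qed (use fing in auto)
  qed
  then show ?thesis
    unfolding prox_subdiff_def using q \<open>\<rho> > 0\<close> \<open>L \<ge> 0\<close> \<open>\<delta> > 0\<close> \<open>\<delta>' > 0\<close>
    by (intro CollectI conjI exI[of _ "\<rho> + L"] exI[of _ "min \<delta> \<delta>'"]) (auto simp: edom_def)
qed

text \<open>Convexity of \<open>h\<close> along the segment carries the local inequality from points
  near \<open>x\<close> to \<open>y\<close>. The local constant \<open>\<sigma>\<close> disappears
  in the limit, leaving the modulus \<open>\<rho>\<close>, which can be compared with the curvature
  of the Bregman term.\<close>

lemma semi_convex_prox_subdiff_global: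
  fixes g :: "real^'n \<Rightarrow> ereal"
  assumes sc: "semi_convex \<rho> g" and fin: "\<And>x. g x \<noteq> -\<infinity>" and \<zeta>: "\<zeta> \<in> prox_subdiff g x"
  shows "g x + ereal (\<zeta> \<bullet> (y - x) - \<rho> / 2 * (norm (y - x))\<^sup>2) \<le> g y"
proof (cases "g y")
  case (real s)
  obtain h where h: "convex_on (edom g) h"
    and gh: "\<And>x. x \<in> edom g \<Longrightarrow> g x = ereal (h x - \<rho> / 2 * (norm x)\<^sup>2)"
    using sc unfolding semi_convex_def by blast
  obtain \<sigma> \<delta> where x: "x \<in> edom g" and "\<sigma> > 0" "\<delta> > 0"
    and le: "\<And>z. z \<in> ball x \<delta> \<Longrightarrow> g x + ereal (\<zeta> \<bullet> (z - x) - \<sigma> * (norm (z - x))\<^sup>2) \<le> g z"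
    using \<zeta> unfolding prox_subdiff_def by blast
  define v where "v = y - x"
  have y: "y \<in> edom g"
    using real by (simp add: edom_def)
  \<comment> \<open>This is the subgradient inequality for \<open>h\<close> with
    \<open>\<zeta> + \<rho> *\<^sub>R x\<close>, the second term being the gradient of the added
    quadratic. The bound on \<open>t\<close> keeps \<open>z\<close> in the ball; the
    \<open>1\<close> in its denominator covers \<open>v = 0\<close>.\<close>
  have "\<zeta> \<bullet> v + \<rho> * (x \<bullet> v) \<le> h y - h x"
  proof (rule le_if_le_add_small[where \<tau> = "min 1 (\<delta> / (norm v + 1))"])
    show "0 < min 1 (\<delta> / (norm v + 1))"
      using \<open>\<delta> > 0\<close> by (simp add: add_nonneg_pos)
    fix t :: real assume t: "0 < t" "t < min 1 (\<delta> / (norm v + 1))"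
    define z where "z = (1 - t) *\<^sub>R x + t *\<^sub>R y"
    have zx: "z - x = t *\<^sub>R v"
      by (simp add: z_def v_def algebra_simps)
    have "t * (norm v + 1) < \<delta>"
      using t by (simp add: pos_less_divide_eq add_nonneg_pos)
    then have "norm (z - x) < \<delta>"
      using t(1) by (simp add: zx algebra_simps)
    then have "z \<in> ball x \<delta>"
      by (simp add: dist_norm norm_minus_commute)
    have "z \<in> edom g"
      unfolding z_def using convex_on_imp_convex[OF h] x y t by (intro convexD) auto
    have hz: "h z \<le> (1 - t) * h x + t * h y"
      unfolding z_def using h x y t by (intro convex_onD) auto
    have "h x - \<rho> / 2 * (norm x)\<^sup>2 + (\<zeta> \<bullet> (z - x) - \<sigma> * (norm (z - x))\<^sup>2) \<le> h z - \<rho> / 2 * (norm z)\<^sup>2"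
      using le[OF \<open>z \<in> ball x \<delta>\<close>] gh[OF x] gh[OF \<open>z \<in> edom g\<close>] by simp
    moreover have "(norm z)\<^sup>2 = (norm x)\<^sup>2 + t * (2 * (x \<bullet> v) + t * (norm v)\<^sup>2)"
    proof -
      have "z = x + t *\<^sub>R v"
        using zx by (simp add: algebra_simps)
      then show ?thesis
        by (simp add: power2_norm_eq_inner inner_add_left inner_add_right inner_commute algebra_simps)
    qed
    moreover have "\<zeta> \<bullet> (z - x) - \<sigma> * (norm (z - x))\<^sup>2 = t * (\<zeta> \<bullet> v - t * \<sigma> * (norm v)\<^sup>2)"
      by (simp add: zx power_mult_distrib power2_eq_square algebra_simps)
    ultimately have "t * (\<zeta> \<bullet> v + \<rho> * (x \<bullet> v)) \<le> t * (h y - h x + t * ((\<sigma> - \<rho> / 2) * (norm v)\<^sup>2))"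
      using hz by (simp add: algebra_simps)
    then show "\<zeta> \<bullet> v + \<rho> * (x \<bullet> v) \<le> h y - h x + t * ((\<sigma> - \<rho> / 2) * (norm v)\<^sup>2)"
      using t(1) by simp
  qed
  moreover have "(norm y)\<^sup>2 = (norm x)\<^sup>2 + 2 * (x \<bullet> v) + (norm v)\<^sup>2"
    by (simp add: v_def power2_norm_eq_inner inner_diff_left inner_diff_right inner_commute)
  ultimately show ?thesis
    using gh[OF x] gh[OF y] by (simp add: v_def[symmetric] algebra_simps)
qed (use fin in auto)

section \<open>The Bregman proximal step\<close>

text \<open>Strong convexity bounds the difference quotients of \<open>K\<close> from
  \<open>x\<close> towards \<open>y\<close>; letting \<open>t\<close> decrease to 0 gives the
  first-order form.\<close>

lemma bregman_dist_lower_bound: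
  assumes K: "bregman_kernel K gradK m M"
  shows "m / 2 * (norm (y - x))\<^sup>2 \<le> bregman_dist K gradK x y"
proof -
  define v where "v = y - x"
  have sc: "K (t *\<^sub>R y + (1 - t) *\<^sub>R x) \<le> t * K y + (1 - t) * K x - m / 2 * t * (1 - t) * (norm v)\<^sup>2"
    if "t \<in> {0..1}" for t
    using K that unfolding bregman_kernel_def strongly_convex_def v_def by blast
  have "(K has_derivative (\<lambda>h. h \<bullet> gradK x)) (at x)"
    using K unfolding bregman_kernel_def gderiv_def by blast
  then have "((\<lambda>t. K (x + t *\<^sub>R v)) has_derivative (\<lambda>t. (t *\<^sub>R v) \<bullet> gradK x)) (at 0)"
    by (intro has_derivative_compose[where g = K and f = "\<lambda>t. x + t *\<^sub>R v"])
      (auto intro!: derivative_eq_intros)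
  then have "((\<lambda>t. K (x + t *\<^sub>R v)) has_real_derivative (v \<bullet> gradK x)) (at 0)"
    by (simp add: has_field_derivative_def mult_commute_abs)
  then have "((\<lambda>t. (K (x + t *\<^sub>R v) - K x) / t) \<longlongrightarrow> v \<bullet> gradK x) (at 0)"
    by (simp add: DERIV_def)
  then have lim: "((\<lambda>t. (K (x + t *\<^sub>R v) - K x) / t) \<longlongrightarrow> v \<bullet> gradK x) (at_right 0)"
    by (rule filterlim_mono) (auto simp: at_le)
  have "v \<bullet> gradK x \<le> K y - K x - m / 2 * (norm v)\<^sup>2"
  proof (rule tendsto_le[OF _ _ lim])
    show "((\<lambda>t. K y - K x - m / 2 * (1 - t) * (norm v)\<^sup>2) \<longlongrightarrow> K y - K x - m / 2 * (norm v)\<^sup>2) (at_right 0)"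
      by (auto intro!: tendsto_eq_intros)
    have "(K (x + t *\<^sub>R v) - K x) / t \<le> K y - K x - m / 2 * (1 - t) * (norm v)\<^sup>2"
      if "0 < t" "t < 1" for t
    proof -
      have eq: "t *\<^sub>R y + (1 - t) *\<^sub>R x = x + t *\<^sub>R v"
        by (simp add: v_def algebra_simps)
      have "K (x + t *\<^sub>R v) - K x \<le> (K y - K x - m / 2 * (1 - t) * (norm v)\<^sup>2) * t"
        using sc[of t, unfolded eq] that by (simp add: algebra_simps)
      then show ?thesis
        using that by (simp add: pos_divide_le_eq)
    qed
    then show "\<forall>\<^sub>F t in at_right 0. (K (x + t *\<^sub>R v) - K x) / t \<le> K y - K x - m / 2 * (1 - t) * (norm v)\<^sup>2"
      by (auto simp: eventually_at_right_field intro!: exI[of _ 1])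
  qed simp
  then show ?thesis
    by (simp add: bregman_dist_def v_def inner_commute)
qed

text \<open>The curvature left after the concavity of \<open>g\<close> is paid for is
  \<open>\<kappa> = m / \<epsilon> - \<rho>\<close>. Outside \<open>cball x R\<close> the term
  \<open>\<kappa> / 2 * n\<^sup>2\<close> dominates \<open>norm \<xi> * n\<close>, so a minimiser
  over this compact ball is a global one.\<close>

lemma bregman_prox_dist_le:
  fixes g :: "real^'n \<Rightarrow> ereal"
  assumes K: "bregman_kernel K gradK m M" and "\<epsilon> > 0" and \<epsilon>: "\<epsilon> * \<rho> < m"
    and sc: "semi_convex \<rho> g" and fin: "\<And>x. g x \<noteq> -\<infinity>" and \<xi>: "\<xi> - gradf x \<in> prox_subdiff g x"
  shows "ext_dist x (bregman_prox gradf g (bregman_dist K gradK) \<epsilon> x)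
    \<le> ereal (2 / (m / \<epsilon> - \<rho>) * norm \<xi>)"
proof -
  define \<kappa> where "\<kappa> = m / \<epsilon> - \<rho>"
  define R where "R = 2 / \<kappa> * norm \<xi>"
  define s where "s z = gradf x \<bullet> (z - x) + 1 / \<epsilon> * bregman_dist K gradK x z" for z
  have "\<kappa> > 0"
    using \<open>\<epsilon> > 0\<close> \<epsilon> by (simp add: \<kappa>_def field_simps)
  then have "R \<ge> 0"
    by (simp add: R_def)
  have prox_eq: "bregman_prox gradf g (bregman_dist K gradK) \<epsilon> x = {y. \<forall>z. g y + ereal (s y) \<le> g z + ereal (s z)}"
  proof -
    have "ereal (gradf x \<bullet> (z - x)) + g z + ereal (1 / \<epsilon> * bregman_dist K gradK x z) = g z + ereal (s z)" for z
      by (cases "g z") (auto simp: s_def)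
    then show ?thesis
      unfolding bregman_prox_def is_arg_min_linorder by simp
  qed
  have "continuous_on UNIV K"
    using K unfolding bregman_kernel_def gderiv_def
    by (meson continuous_at_imp_continuous_on has_derivative_continuous)
  then have cont_s: "continuous_on UNIV s"
    unfolding s_def bregman_dist_def by (intro continuous_intros)
  have [simp]: "s x = 0"
    by (simp add: s_def bregman_dist_def)
  have "lsc g"
    using sc by (simp add: semi_convex_def)
  obtain y where y: "y \<in> cball x R" and min: "\<And>z. z \<in> cball x R \<Longrightarrow> g y + ereal (s y) \<le> g z + ereal (s z)"
  proof (rule compact_attains_min[of "cball x R" "\<lambda>z. g z + ereal (s z)"])
    fix X z a
    assume X: "X \<longlonglongrightarrow> z" and a: "(\<lambda>k. g (X k) + ereal (s (X k))) \<longlonglongrightarrow> a"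
    have "(\<lambda>k. s (X k)) \<longlonglongrightarrow> s z"
      using continuous_on_tendsto_compose[OF cont_s X] by simp
    \<comment> \<open>Removing the continuous finite part \<open>s\<close> isolates
      \<open>g\<close>, whose values may be infinite.\<close>
    then have "(\<lambda>k. (g (X k) + ereal (s (X k))) + ereal (- s (X k))) \<longlonglongrightarrow> a + ereal (- s z)"
      using a by (intro tendsto_add_ereal_general1 tendsto_ereal tendsto_minus) auto
    moreover have "(g (X k) + ereal (s (X k))) + ereal (- s (X k)) = g (X k)" for k
      by (cases "g (X k)") auto
    ultimately have "g z \<le> a + ereal (- s z)"
      using lsc_le_limit[OF \<open>lsc g\<close> X, of "\<lambda>k. g (X k)"] by simp
    then show "g z + ereal (s z) \<le> a"
      by (cases "g z"; cases a) auto
  qed (use \<open>R \<ge> 0\<close> in auto)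
  have "g x + ereal (s x) \<le> g z + ereal (s z)" if z: "z \<notin> cball x R" for z
  proof -
    define n where "n = norm (z - x)"
    have "R \<le> n"
      using z by (simp add: n_def dist_norm norm_minus_commute)
    then have "norm \<xi> \<le> \<kappa> / 2 * n"
      using \<open>\<kappa> > 0\<close> by (simp add: R_def field_simps)
    then have "norm \<xi> * n \<le> \<kappa> / 2 * n * n"
      by (intro mult_right_mono) (auto simp: n_def)
    moreover have "- (norm \<xi> * n) \<le> \<xi> \<bullet> (z - x)"
      using Cauchy_Schwarz_ineq2[of \<xi> "z - x"] by (simp add: n_def)
    ultimately have 1: "0 \<le> \<xi> \<bullet> (z - x) + \<kappa> / 2 * n\<^sup>2"
      by (simp add: power2_eq_square)
    have "1 / \<epsilon> * (m / 2 * n\<^sup>2) \<le> 1 / \<epsilon> * bregman_dist K gradK x z"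
      unfolding n_def using bregman_dist_lower_bound[OF K] \<open>\<epsilon> > 0\<close> by (intro mult_left_mono) auto
    then have 2: "gradf x \<bullet> (z - x) + m / \<epsilon> / 2 * n\<^sup>2 \<le> s z"
      by (simp add: s_def field_simps)
    \<comment> \<open>The two \<open>gradf x\<close> terms cancel, so only \<open>\<xi>\<close> and
      the net curvature \<open>\<kappa>\<close> remain.\<close>
    have "0 \<le> (\<xi> - gradf x) \<bullet> (z - x) - \<rho> / 2 * n\<^sup>2 + s z"
      using 1 2 by (simp add: \<kappa>_def inner_diff_left algebra_simps diff_divide_distrib)
    then have "g x \<le> g x + ereal ((\<xi> - gradf x) \<bullet> (z - x) - \<rho> / 2 * n\<^sup>2) + ereal (s z)"
      by (cases "g x") auto
    also have "\<dots> \<le> g z + ereal (s z)"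
      unfolding n_def using semi_convex_prox_subdiff_global[OF sc fin \<xi>] by (intro add_right_mono)
    finally show ?thesis
      by (simp flip: zero_ereal_def)
  qed
  \<comment> \<open>The centre \<open>x\<close> lies in the ball and links the cases:
    \<open>y\<close> is no worse than \<open>x\<close>, and \<open>x\<close> is no worse than any
    outside point.\<close>
  then have "y \<in> bregman_prox gradf g (bregman_dist K gradK) \<epsilon> x"
    unfolding prox_eq using min[of x] min \<open>R \<ge> 0\<close> by (auto intro: order_trans)
  then have "ext_dist x (bregman_prox gradf g (bregman_dist K gradK) \<epsilon> x) \<le> ereal (norm (x - y))"
    by (rule ext_dist_le)
  also have "\<dots> \<le> ereal R"
    using y by (simp add: dist_norm)
  finally show ?thesis
    by (simp add: R_def \<kappa>_def)
qed

section \<open>Passing between the error bounds\<close>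

lemma bregman_prox_EB_imp_weak_metric_subregular:
  fixes f g :: "real^'n \<Rightarrow> ereal"
  assumes finf: "\<And>x. f x \<noteq> -\<infinity>" and fing: "\<And>x. g x \<noteq> -\<infinity>"
    and grad: "\<And>y. y \<in> edom f \<Longrightarrow> has_gradient f y (gradf y)"
    and lip: "L-lipschitz_on (edom f) gradf"
    and K: "bregman_kernel K gradK m M" and "\<epsilon> > 0" and \<epsilon>: "\<epsilon> * \<rho> < m" and sc: "semi_convex \<rho> g"
    and EB: "bregman_prox_EB (\<lambda>x. f x + g x) gradf g (bregman_dist K gradK) \<epsilon> xb"
  shows "weak_metric_subregular (\<lambda>x. f x + g x) xb"
proof -
  define F where "F = (\<lambda>x. f x + g x)"
  define T where "T = bregman_prox gradf g (bregman_dist K gradK) \<epsilon>"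
  obtain \<eta> \<nu> c where "\<eta> > 0" "\<nu> > 0" "c > 0"
    and c: "\<And>x. x \<in> level_ball F xb \<eta> \<nu> \<Longrightarrow> ext_dist x (prox_critical F) \<le> ereal c * ext_dist x (T x)"
    using EB unfolding bregman_prox_EB_def F_def[symmetric] T_def by blast
  define k where "k = 2 / (m / \<epsilon> - \<rho>)"
  have "k > 0"
    using \<open>\<epsilon> > 0\<close> \<epsilon> by (simp add: k_def field_simps)
  have "ext_dist x (prox_critical F) \<le> ereal (c * k) * ext_dist 0 (prox_subdiff F x)"
    if x: "x \<in> level_ball F xb \<eta> \<nu>" for x
  proof -
    \<comment> \<open>Dividing by \<open>k\<close> first leaves a bare infimum on the right, so an
      empty subdifferential needs no separate case.\<close>
    have "ext_dist x (T x) / ereal k \<le> ext_dist 0 (prox_subdiff F x)"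
      unfolding ext_dist_def[of 0]
    proof (rule INF_greatest)
      fix \<xi> assume "\<xi> \<in> prox_subdiff F x"
      then have "\<xi> - gradf x \<in> prox_subdiff g x"
        using prox_subdiff_minus_gradient[OF finf fing grad lip] by (simp add: F_def)
      then have "ext_dist x (T x) \<le> ereal (k * norm \<xi>)"
        unfolding T_def k_def using bregman_prox_dist_le[OF K \<open>\<epsilon> > 0\<close> \<epsilon> sc fing] by blast
      then show "ext_dist x (T x) / ereal k \<le> ereal (norm (0 - \<xi>))"
        using \<open>k > 0\<close> by (simp add: ereal_divide_le_pos)
    qed
    then have "ext_dist x (T x) \<le> ereal k * ext_dist 0 (prox_subdiff F x)"
      using \<open>k > 0\<close> by (simp add: ereal_divide_le_pos)
    then have "ereal c * ext_dist x (T x) \<le> ereal c * (ereal k * ext_dist 0 (prox_subdiff F x))"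
      using \<open>c > 0\<close> by (intro ereal_mult_left_mono) auto
    then show ?thesis
      using c[OF x] by (simp add: mult.assoc flip: times_ereal.simps(1))
  qed
  then show ?thesis
    unfolding weak_metric_subregular_def F_def[symmetric]
    using \<open>\<eta> > 0\<close> \<open>\<nu> > 0\<close> \<open>c > 0\<close> \<open>k > 0\<close> by (intro exI[of _ \<eta>] exI[of _ \<nu>] exI[of _ "c * k"] conjI) auto
qed

text \<open>For \<open>x\<close> within \<open>\<delta> / 2\<close> of \<open>xb\<close>, a critical
  point within \<open>\<delta> / 2\<close> of \<open>x\<close> is in reach of (H) and lies in the
  level set; a farther one is no closer to \<open>x\<close> than \<open>xb\<close>, itself in the
  level set.\<close>

lemma weak_metric_subregular_imp_level_set_EB_at:
  fixes F :: "real^'n \<Rightarrow> ereal"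
  assumes xb: "xb \<in> prox_critical F" and H: "assumptionH F xb" and sub: "weak_metric_subregular F xb"
  shows "level_set_EB_at F xb 1"
proof -
  obtain \<delta> where "\<delta> > 0" and \<delta>: "\<And>y. y \<in> prox_critical F \<Longrightarrow> norm (y - xb) \<le> \<delta> \<Longrightarrow> F y \<le> F xb"
    using H unfolding assumptionH_def by blast
  obtain \<eta> \<nu> c where "\<eta> > 0" "\<nu> > 0" "c > 0" and c: "\<And>x. x \<in> level_ball F xb \<eta> \<nu> \<Longrightarrow>
      ext_dist x (prox_critical F) \<le> ereal c * ext_dist 0 (prox_subdiff F x)"
    using sub unfolding weak_metric_subregular_def by blast
  define S where "S = {y. F y \<le> F xb}"
  have "xb \<in> S"
    by (simp add: S_def)
  have "ereal (real_of_ereal (ext_dist x S) powr 1) \<le> ereal c * ext_dist 0 (prox_subdiff F x)"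
    if x: "x \<in> level_ball F xb (min \<eta> (\<delta> / 2)) \<nu>" for x
  proof -
    have xb_x: "norm (x - xb) < \<delta> / 2"
      using x by (simp add: level_ball_def dist_norm norm_minus_commute)
    have "ereal (real_of_ereal (ext_dist x S) powr 1) = ext_dist x S"
      using \<open>xb \<in> S\<close> by (subst (1 2) ext_dist_eq_infdist) (auto simp: infdist_nonneg)
    also have "\<dots> \<le> ext_dist x (prox_critical F)"
      unfolding ext_dist_def[of x "prox_critical F"]
    proof (rule INF_greatest)
      fix z assume z: "z \<in> prox_critical F"
      show "ext_dist x S \<le> ereal (norm (x - z))"
      proof (cases "norm (x - z) < \<delta> / 2")
        case True
        then have "norm (z - xb) \<le> \<delta>"
          using xb_x norm_triangle_ineq[of "z - x" "x - xb"] by (simp add: norm_minus_commute)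
        then show ?thesis
          using \<delta>[OF z] by (intro ext_dist_le) (simp add: S_def)
      next
        case False
        then have "ereal (norm (x - xb)) \<le> ereal (norm (x - z))"
          using xb_x by simp
        then show ?thesis
          using ext_dist_le[OF \<open>xb \<in> S\<close>, of x] by (rule order_trans[rotated])
      qed
    qed
    also have "\<dots> \<le> ereal c * ext_dist 0 (prox_subdiff F x)"
      using x by (intro c) (auto simp: level_ball_def)
    finally show ?thesis .
  qed
  then show ?thesis
    unfolding level_set_EB_at_def level_set_EB_def S_def[symmetric]
    using \<open>\<eta> > 0\<close> \<open>\<delta> > 0\<close> \<open>\<nu> > 0\<close> \<open>c > 0\<close>
    by (intro exI[of _ "min \<eta> (\<delta> / 2)"] exI[of _ \<nu>] exI[of _ c] conjI) auto
qed

text \<open>At \<open>\<alpha> = 0\<close> the exponent \<open>\<gamma>\<close> is 0, so its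
  positivity is claimed only for \<open>\<alpha> \<noteq> 0\<close>. The condition
  \<open>\<epsilon> * \<rho> < m\<close> makes the curvature of the Bregman term exceed the modulus
  of \<open>g\<close>, which yields a minimiser of the Bregman objective at points where
  \<open>F\<close> has a proximal subgradient.\<close>

theorem theorem5p1:
  fixes f g F :: "real^'n \<Rightarrow> ereal"
    and gradf gradK :: "real^'n \<Rightarrow> real^'n"
    and K :: "real^'n \<Rightarrow> real"
    and L m M \<epsilon> \<epsilon>lo \<epsilon>hi :: real
    and xb :: "real^'n"
  assumes "\<And>x. f x \<noteq> -\<infinity>" and "\<And>x. g x \<noteq> -\<infinity>"
    and "F = (\<lambda>x. f x + g x)"
    and "proper_fun F" and "lsc F"
    and "xb \<in> edom F"
  shows
    "(\<forall>\<alpha> \<gamma> \<eta> \<nu>. \<alpha> \<in> {0..<1} \<and> \<eta> > 0 \<and> \<nu> > 0 \<and> \<gamma> = \<alpha> / (1 - \<alpha>) \<and> KL_property F xb \<alpha> \<eta> \<nu> \<longrightarrow>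
        level_set_EB F xb \<gamma> (\<eta> / 2) \<nu> \<and>
        \<alpha> = \<gamma> / (1 + \<gamma>) \<and>
        (\<alpha> \<in> {0..1/2} \<longrightarrow> \<gamma> \<in> {0..1} \<and> (\<alpha> \<noteq> 0 \<longrightarrow> \<gamma> \<in> {0<..1})) \<and>
        (\<alpha> \<in> {1/2<..<1} \<longrightarrow> \<gamma> > 1))
     \<and>
     (assumption1 f gradf L g \<and> xb \<in> prox_critical F \<and> assumptionH F xb \<and>
        ((bregman_kernel K gradK m M \<and> 0 < \<epsilon>lo \<and> \<epsilon>lo \<le> \<epsilon> \<and> \<epsilon> \<le> \<epsilon>hi \<and>
          bregman_prox_EB F gradf g (bregman_dist K gradK) \<epsilon> xb \<and>
          (\<exists>\<rho>. semi_convex \<rho> g \<and> \<epsilon> * \<rho> < m))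
         \<or> weak_metric_subregular F xb)
      \<longrightarrow> level_set_EB_at F xb 1)"
proof (intro conjI allI impI)
  have fin: "F x \<noteq> -\<infinity>" for x
    using \<open>proper_fun F\<close> by (simp add: proper_fun_def)
  fix \<alpha> \<gamma> \<eta> \<nu> :: real
  assume *: "\<alpha> \<in> {0..<1} \<and> \<eta> > 0 \<and> \<nu> > 0 \<and> \<gamma> = \<alpha> / (1 - \<alpha>) \<and> KL_property F xb \<alpha> \<eta> \<nu>"
  then show "level_set_EB F xb \<gamma> (\<eta> / 2) \<nu>"
    using KL_imp_level_set_EB[OF \<open>lsc F\<close> fin \<open>xb \<in> edom F\<close>] by auto
  have \<alpha>: "0 \<le> \<alpha>" "\<alpha> < 1" "\<gamma> = \<alpha> / (1 - \<alpha>)"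
    using * by auto
  have "\<alpha> / (1 - \<alpha>) / (1 + \<alpha> / (1 - \<alpha>)) = \<alpha>"
    using \<alpha>(2) by (simp add: field_simps)
  then show "\<alpha> = \<gamma> / (1 + \<gamma>)"
    by (simp only: \<alpha>(3))
  show "\<gamma> \<in> {0..1}" if "\<alpha> \<in> {0..1/2}"
    using \<alpha> that by (simp add: divide_le_eq)
  show "\<gamma> \<in> {0<..1}" if "\<alpha> \<in> {0..1/2}" "\<alpha> \<noteq> 0"
    using \<alpha> that by (simp add: divide_le_eq)
  show "\<gamma> > 1" if "\<alpha> \<in> {1/2<..<1}"
    using \<alpha> that by (simp add: less_divide_eq)
next
  assume *: "assumption1 f gradf L g \<and> xb \<in> prox_critical F \<and> assumptionH F xb \<and>
      ((bregman_kernel K gradK m M \<and> 0 < \<epsilon>lo \<and> \<epsilon>lo \<le> \<epsilon> \<and> \<epsilon> \<le> \<epsilon>hi \<and>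
        bregman_prox_EB F gradf g (bregman_dist K gradK) \<epsilon> xb \<and>
        (\<exists>\<rho>. semi_convex \<rho> g \<and> \<epsilon> * \<rho> < m))
       \<or> weak_metric_subregular F xb)"
  have "weak_metric_subregular F xb"
  \<comment> \<open>If condition (ii) fails, condition (i) must be the one that holds.\<close>
  proof (cases "weak_metric_subregular F xb")
    case False
    then obtain \<rho> where \<rho>: "bregman_kernel K gradK m M" "\<epsilon> > 0" "\<epsilon> * \<rho> < m" "semi_convex \<rho> g"
      "bregman_prox_EB (\<lambda>x. f x + g x) gradf g (bregman_dist K gradK) \<epsilon> xb"
      using * \<open>F = _\<close> by auto
    have "\<And>y. y \<in> edom f \<Longrightarrow> has_gradient f y (gradf y)" and "L-lipschitz_on (edom f) gradf"
      using * by (auto simp: assumption1_def)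
    then show ?thesis
      unfolding \<open>F = _\<close> by (rule bregman_prox_EB_imp_weak_metric_subregular[OF assms(1,2) _ _ \<rho>])
  qed
  then show "level_set_EB_at F xb 1"
    using * weak_metric_subregular_imp_level_set_EB_at by blast
qed

end
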